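(* Let $u^\dagger$ be a $J$-minimizing solution of $Ku=g$ that satisfies the source condition $K^*p^\dagger\in\partial J(u^\dagger)$ with source element $p^\dagger\in H_2$, and let $\Gamma$ be Morozov's discrepancy principle with parameter $\rho>1$. Then, for data $g^\delta\in H_2$ with $\|g^\delta-g\|\le\delta$, as $\delta\to0$, $$D_J^{\mathrm{sym}}(u^\delta_{\Gamma(\delta,g^\delta)},u^\dagger)\le\left(1+\mathcal{O}(\sqrt{\delta})\right)\frac{\rho(\sqrt{\rho}+1)}{\sqrt{\rho-1}}\,\|p_0-p^\dagger\|\,\delta .$$
   Context: $H_1,H_2$ are separable (real) Hilbert spaces, $K:H_1\to H_2$ is linear and bounded with adjoint $K^*$, and $J:H_1\to\mathbb{R}\cup\{\infty\}$ is convex, lower semicontinuous and proper with domain $D(J)=\{u: J(u)<\infty\}$. It is assumed that for every $c\in\mathbb{R}$ every sequence in $\{u\in H_1:\|Ku\|^2+J(u)\le c\}$ has a weakly convergent subsequence in $H_1$. The element $g\in H_2$ is attainable, i.e. $Ku=g$ for some $u\in D(J)$. A $J$-minimizing solution of $Ku=g$ is a minimizer of $J(u)$ subject to $Ku=g$. Augmented Lagrangian method: $\{\tau_n\}_{n\ge1}$ is a fixed sequence of positive numbers, $t_n:=\sum_{k=1}^n\tau_k$, with $t_n\to+\infty$ and $\bar\tau:=\sup_k\tau_k<\infty$. Given data $g^\delta$ and a fixed starting element $p_0^\delta=p_0\in H_2$, for $n=1,2,\dots$ $$u_n^\delta\in\operatorname{argmin}_{u\in H_1}\Big(\tfrac{\tau_n}{2}\|Ku-g^\delta\|^2+J(u)-\langle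 p_{n-1}^\delta,Ku-g^\delta\rangle\Big),\qquad p_n^\delta=p_{n-1}^\delta+\tau_n(g^\delta-Ku_n^\delta).$$ One has $K^*p_n^\delta\in\partial J(u_n^\delta)$. Morozov's discrepancy principle with $\rho>1$ is the stopping rule $\Gamma(\delta,g^\delta):=\min\{n\in\mathbb{N}, n\ge1:\ \|Ku_n^\delta-g^\delta\|<\rho\delta\}$ (this minimum exists). The symmetric Bregman distance, for $\eta\in\partial J(v)$ and $\xi\in\partial J(u)$, is $D_J^{\mathrm{sym}}(v,u)=\langle\eta-\xi,v-u\rangle$; in $D_J^{\mathrm{sym}}(u_n^\delta,u^\dagger)$ the subgradients used are $K^*p_n^\delta\in\partial J(u_n^\delta)$ and $K^*p^\dagger\in\partial J(u^\dagger)$. $\mathcal{O}(\sqrt\delta)$ denotes a quantity bounded in absolute value by $C\sqrt\delta$ for all sufficiently small $\delta>0$, with $C$ independent of $\delta$.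
   Formalization: The formal statement additionally assumes p_0 ≠ p†; for p_0 = p† the right-hand side is zero and the claim fails, e.g. K = id on ℝ, J(u) = u²/2, g = u† = p† = p_0 = 1, g^δ = 1 + δ. *)

theory Defs
  imports "HOL-Analysis.Analysis" "HOL-Library.Landau_Symbols"
begin

text \<open>
  Functionals with values in \<open>\<real> \<union> {\<infinity>}\<close> have type \<^typ>\<open>ereal\<close>; that the value \<open>-\<infinity>\<close> is
  excluded is part of \<open>proper\<close>.
\<close>

definition proper :: "('a \<Rightarrow> ereal) \<Rightarrow> bool" where
  "proper J \<longleftrightarrow> (\<forall>u. J u \<noteq> -\<infinity>) \<and> (\<exists>u. J u < \<infinity>)"

text \<open>At \<open>t = 0\<close> and \<open>t = 1\<close> the convention \<open>0 * \<infinity> = 0\<close> of \<^typ>\<open>ereal\<close> makes the inequality trivial.\<close>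

definition ereal_convex :: "('a::real_vector \<Rightarrow> ereal) \<Rightarrow> bool" where
  "ereal_convex J \<longleftrightarrow>
     (\<forall>u v. \<forall>t\<in>{0..1}. J ((1 - t) *\<^sub>R u + t *\<^sub>R v) \<le> ereal (1 - t) * J u + ereal t * J v)"

definition lower_semicontinuous :: "('a::topological_space \<Rightarrow> ereal) \<Rightarrow> bool" where
  "lower_semicontinuous J \<longleftrightarrow> (\<forall>u. J u \<le> Liminf (at u) J)"

definition weakly_converges_to :: "(nat \<Rightarrow> 'a::real_normed_vector) \<Rightarrow> 'a \<Rightarrow> bool" where
  "weakly_converges_to X x \<longleftrightarrow>
     (\<forall>f::'a \<Rightarrow> real. bounded_linear f \<longrightarrow> (\<lambda>n. f (X n)) \<longlonglongrightarrow> f x)"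

definition weakly_precompact_seq :: "'a::real_normed_vector set \<Rightarrow> bool" where
  "weakly_precompact_seq S \<longleftrightarrow>
     (\<forall>X::nat \<Rightarrow> 'a. range X \<subseteq> S \<longrightarrow> (\<exists>(r::nat \<Rightarrow> nat) x. strict_mono r \<and> weakly_converges_to (X \<circ> r) x))"

text \<open>For proper \<open>J\<close> this set is empty wherever \<open>J u = \<infinity>\<close>.\<close>

definition subdifferential :: "('a::real_inner \<Rightarrow> ereal) \<Rightarrow> 'a \<Rightarrow> 'a set" where
  "subdifferential J u = {\<xi>. \<forall>v. J u + ereal (\<xi> \<bullet> (v - u)) \<le> J v}"

text \<open>
  The symmetric Bregman distance of \<open>v\<close> and \<open>u\<close> with respect to \<open>J\<close> depends on \<open>J\<close> only through
  the chosen subgradients \<open>\<eta> \<in> subdifferential J v\<close> and \<open>\<xi> \<in> subdifferential J u\<close>, which are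
  therefore explicit arguments.
\<close>

definition sym_bregman :: "'a::real_inner \<Rightarrow> 'a \<Rightarrow> 'a \<Rightarrow> 'a \<Rightarrow> real" where
  "sym_bregman \<eta> \<xi> v u = (\<eta> - \<xi>) \<bullet> (v - u)"

definition J_minimizing_solution ::
    "('a \<Rightarrow> ereal) \<Rightarrow> ('a \<Rightarrow> 'b) \<Rightarrow> 'b \<Rightarrow> 'a \<Rightarrow> bool" where
  "J_minimizing_solution J K g u \<longleftrightarrow> is_arg_min J (\<lambda>v. K v = g) u"

text \<open>
  The minimizers \<open>u n\<close> need not be unique, so an augmented Lagrangian run is a relation rather
  than a function of the data. The value \<open>u 0\<close> is irrelevant, as is \<open>\<tau> 0\<close>.
\<close>

definition augmented_lagrangian ::
    "('a::real_inner \<Rightarrow> 'b::real_inner) \<Rightarrow> ('a \<Rightarrow> ereal) \<Rightarrow> (nat \<Rightarrow> real) \<Rightarrow> 'b \<Rightarrow> 'b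
      \<Rightarrow> (nat \<Rightarrow> 'a) \<Rightarrow> (nat \<Rightarrow> 'b) \<Rightarrow> bool" where
  "augmented_lagrangian K J \<tau> p0 gd u p \<longleftrightarrow>
     p 0 = p0 \<and>
     (\<forall>n\<ge>1.
        is_arg_min (\<lambda>v. ereal (\<tau> n / 2 * (norm (K v - gd))\<^sup>2) + J v
                          - ereal (p (n - 1) \<bullet> (K v - gd))) (\<lambda>v. True) (u n) \<and>
        p n = p (n - 1) + \<tau> n *\<^sub>R (gd - K (u n)))"

definition morozov_index ::
    "real \<Rightarrow> ('a \<Rightarrow> 'b::real_normed_vector) \<Rightarrow> (nat \<Rightarrow> 'a) \<Rightarrow> real \<Rightarrow> 'b \<Rightarrow> nat" where
  "morozov_index \<rho> K u \<delta> gd = (LEAST n. n \<ge> 1 \<and> norm (K (u n) - gd) < \<rho> * \<delta>)"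

end

theory Submission
  imports Defs
begin

text \<open>
  The multipliers \<open>p n\<close> form a proximal point iteration for the dual functional
  \<open>G q = J\<^sup>* (K\<^sup>* q) - q \<bullet> gd\<close>, with the residual \<open>r n = K (u n) - gd\<close>
  as subgradient at \<open>p n\<close>.
  With \<open>e n = p n - p_dag\<close> the energy
  \<open>t n * (G (p n) - G p_dag) + (t n)\<^sup>2 * \<parallel>r n\<parallel>\<^sup>2 / 2 + \<parallel>e n\<parallel>\<^sup>2 / 2\<close> does not increase, and
  \<open>G (p n) - G p_dag \<ge> - \<delta> * \<parallel>e n\<parallel>\<close> by the source condition. Hence
  \<open>\<parallel>e n\<parallel>\<^sup>2 - 2 * t n * \<delta> * \<parallel>e n\<parallel> + (t n)\<^sup>2 * \<parallel>r n\<parallel>\<^sup>2 \<le> \<parallel>e 0\<parallel>\<^sup>2\<close>. This forces the discrepancy principle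
  to stop, and, one step before stopping, where \<open>\<parallel>r n\<parallel> \<ge> \<rho> * \<delta>\<close>, it yields
  \<open>\<parallel>e n\<parallel> \<le> \<rho> / sqrt (\<rho>\<^sup>2 - 1) * \<parallel>e 0\<parallel>\<close>. The last step adds at most \<open>O(\<delta>)\<close> to \<open>\<parallel>e n\<parallel>\<close>, and the Bregman
  distance \<open>e N \<bullet> (K (u N) - g)\<close> is at most \<open>\<parallel>e N\<parallel> * (\<rho> + 1) * \<delta>\<close>.
\<close>

section \<open>Riesz representation and the Hilbert space adjoint\<close>

text \<open>
  The representing vector is the minimizer of \<open>x \<bullet> x - 2 * f x\<close>; minimizing sequences are Cauchy by
  the parallelogram law.
\<close>

lemma riesz_representation_exists:
  fixes f :: "'a::{real_inner, complete_space} \<Rightarrow> real"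
  assumes "bounded_linear f"
  shows "\<exists>z. \<forall>x. f x = x \<bullet> z"
proof -
  interpret f: bounded_linear f by fact
  define \<Phi> where "\<Phi> x = x \<bullet> x - 2 * f x" for x
  obtain B where B: "\<And>x. \<bar>f x\<bar> \<le> norm x * B"
    using f.bounded by auto
  have bound: "- B\<^sup>2 \<le> \<Phi> x" for x
  proof -
    have "0 \<le> (norm x - B)\<^sup>2" by simp
    then show ?thesis
      using B[of x] unfolding \<Phi>_def by (simp add: power2_norm_eq_inner[symmetric] power2_diff)
  qed
  then have bdd: "bdd_below (range \<Phi>)"
    by (auto simp: bdd_below_def)
  define m where "m = (INF x. \<Phi> x)"
  have m_le: "m \<le> \<Phi> x" for x
    unfolding m_def using bdd by (simp add: cINF_lower)
  have "\<exists>x. \<Phi> x < m + 1 / real (Suc n)" for n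
    using cINF_less_iff[of UNIV \<Phi> "m + 1 / real (Suc n)"] bdd by (simp add: m_def)
  then obtain X where X: "\<And>n. \<Phi> (X n) < m + 1 / real (Suc n)"
    by metis
  have parallelogram: "(norm (x - y))\<^sup>2 \<le> 2 * (\<Phi> x - m) + 2 * (\<Phi> y - m)" for x y
  proof -
    have "(norm (x - y))\<^sup>2 = 2 * \<Phi> x + 2 * \<Phi> y - 4 * \<Phi> ((1 / 2) *\<^sub>R (x + y))"
      unfolding \<Phi>_def
      by (simp add: power2_norm_eq_inner f.add f.scaleR inner_add inner_diff inner_commute algebra_simps)
    then show ?thesis using m_le[of "(1 / 2) *\<^sub>R (x + y)"] by simp
  qed
  have "Cauchy X"
  proof (rule metric_CauchyI)
    fix e :: real assume "0 < e"
    then obtain M where M: "1 / real (Suc M) < e\<^sup>2 / 4"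
      using nat_approx_posE[of "e\<^sup>2 / 4"] by auto
    have "dist (X k) (X n) < e" if "k \<ge> M" "n \<ge> M" for k n
    proof -
      have "\<Phi> (X i) - m < e\<^sup>2 / 4" if "i \<ge> M" for i
      proof -
        have "1 / real (Suc i) \<le> 1 / real (Suc M)" using that by (simp add: frac_le)
        then show ?thesis using X[of i] M by linarith
      qed
      from this[OF that(1)] this[OF that(2)] parallelogram[of "X k" "X n"]
      have "(norm (X k - X n))\<^sup>2 < e\<^sup>2" by argo
      then show ?thesis
        using \<open>0 < e\<close> by (simp add: dist_norm power2_less_imp_less)
    qed
    then show "\<exists>M. \<forall>k\<ge>M. \<forall>n\<ge>M. dist (X k) (X n) < e" by blast
  qed
  then obtain z where z: "X \<longlonglongrightarrow> z"
    by (auto simp: Cauchy_convergent_iff convergent_def)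
  have "(\<lambda>n. \<Phi> (X n)) \<longlonglongrightarrow> \<Phi> z"
    unfolding \<Phi>_def by (intro tendsto_intros f.tendsto z)
  moreover have "(\<lambda>n. m + 1 / real (Suc n)) \<longlonglongrightarrow> m + 0"
    by (intro tendsto_intros LIMSEQ_Suc[OF lim_1_over_n])
  moreover have "\<exists>k. \<forall>n\<ge>k. \<Phi> (X n) \<le> m + 1 / real (Suc n)"
    using less_imp_le[OF X] by blast
  ultimately have "\<Phi> z \<le> m + 0"
    by (rule LIMSEQ_le)
  then have z_min: "\<Phi> z \<le> m" by simp
  have "f x = x \<bullet> z" for x
  proof (rule ccontr)
    define c where "c = x \<bullet> z - f x"
    assume "f x \<noteq> x \<bullet> z"
    then have c: "c \<noteq> 0" by (simp add: c_def)
    \<comment> \<open>The optimal step would be \<open>- c / (x \<bullet> x)\<close>. Adding 1 keeps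
      \<open>q\<close> positive without a case split on \<open>x = 0\<close>, and the quadratic is
      still negative at \<open>- c / q\<close>.\<close>
    define q where "q = x \<bullet> x + 1"
    have q: "q > 0" by (simp add: q_def add_nonneg_pos)
    have "\<Phi> (z + t *\<^sub>R x) = \<Phi> z + 2 * t * c + t\<^sup>2 * (x \<bullet> x)" for t
      unfolding \<Phi>_def c_def
      by (simp add: f.add f.scaleR inner_add inner_commute power2_eq_square algebra_simps)
    then have "0 \<le> 2 * t * c + t\<^sup>2 * (x \<bullet> x)" for t
      using m_le[of "z + t *\<^sub>R x"] z_min by (smt (verit))
    from this[of "- c / q"] have "0 \<le> - 2 * c\<^sup>2 / q + c\<^sup>2 / q\<^sup>2 * (q - 1)"
      by (simp add: q_def power2_eq_square)
    also have "\<dots> = - (c\<^sup>2 / q) - c\<^sup>2 / q\<^sup>2"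
      using q by (simp add: field_simps power2_eq_square)
    finally have "c\<^sup>2 / q + c\<^sup>2 / q\<^sup>2 \<le> 0" by simp
    moreover have "c\<^sup>2 / q > 0" "c\<^sup>2 / q\<^sup>2 > 0" using c q by simp_all
    ultimately show False by linarith
  qed
  then show ?thesis by blast
qed

text \<open>\<open>adjoint\<close> is defined by choice, so its characteristic property holds only
  once some adjoint is known to exist; Riesz supplies one.\<close>

lemma adjoint_inner:
  fixes K :: "'a::{real_inner, complete_space} \<Rightarrow> 'b::real_inner"
  assumes "bounded_linear K"
  shows "adjoint K y \<bullet> x = y \<bullet> K x"
proof -
  have "\<forall>y. \<exists>z. \<forall>x. K x \<bullet> y = x \<bullet> z"
    using riesz_representation_exists[OF bounded_linear_compose[OF bounded_linear_inner_left assms]]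
    by simp
  then have "\<exists>K'. \<forall>x y. K x \<bullet> y = x \<bullet> K' y" by metis
  then have "\<forall>x y. K x \<bullet> y = x \<bullet> adjoint K y"
    unfolding adjoint_def by (rule someI_ex)
  then show ?thesis by (simp add: inner_commute)
qed

section \<open>First-order optimality of a single step\<close>

lemma subdifferential_proper_finite:
  assumes "proper J" "\<xi> \<in> subdifferential J u"
  shows "\<bar>J u\<bar> \<noteq> \<infinity>"
proof -
  obtain v where "J v < \<infinity>" using assms by (auto simp: proper_def)
  moreover have "J u + ereal (\<xi> \<bullet> (v - u)) \<le> J v"
    using assms by (simp add: subdifferential_def)
  ultimately show ?thesis using assms(1) by (cases "J u") (auto simp: proper_def)
qed

text \<open>Dividing by \<open>s\<close> and letting \<open>s\<close> tend to 0 from the right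
  removes the second-order term; this turns minimality along a segment into a first-order
  condition.\<close>

lemma nonneg_if_quadratic_nonneg:
  fixes a b :: real
  assumes "\<And>s. 0 < s \<Longrightarrow> s < 1 \<Longrightarrow> 0 \<le> s * a + s\<^sup>2 * b"
  shows "0 \<le> a"
proof -
  have "((\<lambda>s. a + s * b) \<longlongrightarrow> a + 0 * b) (at_right 0)"
    by (intro tendsto_intros)
  moreover have "\<forall>\<^sub>F s in at_right 0. 0 \<le> a + s * b"
    using eventually_at_right_real[OF zero_less_one]
  proof eventually_elim
    case (elim s)
    then have "0 \<le> s * (a + s * b)"
      using assms[of s] by (simp add: power2_eq_square algebra_simps)
    then show ?case using elim by (simp add: zero_le_mult_iff)
  qed
  ultimately show ?thesis using tendsto_lowerbound by fastforce
qed

text \<open>\<open>p + c *\<^sub>R (gd - K u)\<close> is the updated multiplier, so the second claim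
  says that its image under the adjoint is a subgradient of \<open>J\<close> at \<open>u\<close>. On
  the segment from \<open>u\<close> to \<open>v\<close>, convexity bounds \<open>J\<close> linearly
  and the square adds only a first-order and an \<open>s\<^sup>2\<close> term.\<close>

lemma argmin_subgradient_ineq:
  fixes K :: "'a::real_inner \<Rightarrow> 'b::real_inner"
  assumes "linear K" "ereal_convex J" "proper J"
    and argmin: "is_arg_min (\<lambda>v. ereal (c / 2 * (norm (K v - gd))\<^sup>2) + J v
                  - ereal (p \<bullet> (K v - gd))) (\<lambda>v. True) u"
  shows "\<bar>J u\<bar> \<noteq> \<infinity>"
    and "J u + ereal ((p + c *\<^sub>R (gd - K u)) \<bullet> (K v - K u)) \<le> J v"
proof -
  interpret K: linear K by fact
  let ?F = "\<lambda>v. ereal (c / 2 * (norm (K v - gd))\<^sup>2) + J v - ereal (p \<bullet> (K v - gd))"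
  have min: "?F u \<le> ?F v" for v
    using argmin by (auto simp: is_arg_min_def not_less)
  have nm: "J v \<noteq> -\<infinity>" for v using \<open>proper J\<close> by (simp add: proper_def)
  show fin: "\<bar>J u\<bar> \<noteq> \<infinity>"
  proof -
    obtain v where "J v < \<infinity>" using \<open>proper J\<close> by (auto simp: proper_def)
    then show ?thesis using min[of v] nm[of u] nm[of v] by (cases "J u"; cases "J v") auto
  qed
  then obtain a where a: "J u = ereal a" by (cases "J u") auto
  show "J u + ereal ((p + c *\<^sub>R (gd - K u)) \<bullet> (K v - K u)) \<le> J v"
  proof (cases "J v = \<infinity>")
    case False
    then obtain b where b: "J v = ereal b" using nm[of v] by (cases "J v") auto
    define h r where "h = K v - K u" and "r = K u - gd"
    have "0 \<le> b - a - (p - c *\<^sub>R r) \<bullet> h"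
    proof (rule nonneg_if_quadratic_nonneg)
      fix s :: real assume s: "0 < s" "s < 1"
      define w where "w = (1 - s) *\<^sub>R u + s *\<^sub>R v"
      have Kw: "K w - gd = r + s *\<^sub>R h"
        by (simp add: w_def h_def r_def K.add K.diff K.scale algebra_simps)
      have "J w \<le> ereal ((1 - s) * a + s * b)"
        using \<open>ereal_convex J\<close>[unfolded ereal_convex_def, rule_format, of s u v] s
        by (simp add: w_def a b)
      then obtain d where d: "J w = ereal d" "d \<le> (1 - s) * a + s * b"
        using nm[of w] by (cases "J w") auto
      have "c / 2 * (norm r)\<^sup>2 + a - p \<bullet> r \<le> c / 2 * (norm (r + s *\<^sub>R h))\<^sup>2 + d - p \<bullet> (r + s *\<^sub>R h)"
        using min[of w] by (simp add: a d(1) Kw) (simp add: r_def)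
      moreover have "(norm (r + s *\<^sub>R h))\<^sup>2 = (norm r)\<^sup>2 + 2 * s * (r \<bullet> h) + s\<^sup>2 * (norm h)\<^sup>2"
        unfolding power2_norm_eq_inner
        by (simp add: inner_add inner_commute power2_eq_square algebra_simps)
      ultimately show "0 \<le> s * (b - a - (p - c *\<^sub>R r) \<bullet> h) + s\<^sup>2 * (c / 2 * (norm h)\<^sup>2)"
        using d(2) by (simp add: inner_add inner_diff algebra_simps)
    qed
    then show ?thesis by (simp add: a b h_def r_def algebra_simps)
  qed simp
qed

section \<open>The dual proximal point iteration and its energy\<close>

text \<open>In the application \<open>a n = K (u n)\<close>, \<open>j n = J (u n)\<close> for
  \<open>n \<ge> 1\<close>, and \<open>j_dag = J u_dag\<close>. The inequalities are the subgradient
  relations at an iterate tested at another iterate, at an iterate tested at the solution, and at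
  the solution tested at an iterate. They start at \<open>Suc\<close> because \<open>u 0\<close> is
  arbitrary.\<close>

locale dual_proximal_point =
  fixes p a :: "nat \<Rightarrow> 'b::real_inner" and j \<tau> :: "nat \<Rightarrow> real"
    and g gd p_dag :: 'b and j_dag :: real
  assumes step_pos: "\<tau> (Suc n) > 0"
    and step: "p (Suc n) = p n + \<tau> (Suc n) *\<^sub>R (gd - a (Suc n))"
    and subgradient: "j (Suc m) + p (Suc m) \<bullet> (a (Suc n) - a (Suc m)) \<le> j (Suc n)"
    and subgradient_dag: "j (Suc n) + p (Suc n) \<bullet> (g - a (Suc n)) \<le> j_dag"
    and dag_subgradient: "j_dag + p_dag \<bullet> (a (Suc n) - g) \<le> j (Suc n)"
begin

definition t :: "nat \<Rightarrow> real" where "t n = (\<Sum>k=1..n. \<tau> k)"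
definition r :: "nat \<Rightarrow> 'b" where "r n = a n - gd"
definition e :: "nat \<Rightarrow> 'b" where "e n = p n - p_dag"

text \<open>
  With \<open>G q = J\<^sup>* (K\<^sup>* q) - q \<bullet> gd\<close>, Fenchel's equality gives
  \<open>gap n = G (p n) - G p_dag\<close> for \<open>n \<ge> 1\<close>; the value at \<open>n = 0\<close> is junk, and is only ever
  multiplied by \<open>t 0 = 0\<close>.
\<close>

definition gap :: "nat \<Rightarrow> real" where
  "gap n = (p n \<bullet> r n - j n) - (p_dag \<bullet> (g - gd) - j_dag)"

lemma t_0 [simp]: "t 0 = 0"
  and t_Suc [simp]: "t (Suc n) = t n + \<tau> (Suc n)"
  by (simp_all add: t_def)

lemma t_nonneg: "0 \<le> t n"
  using step_pos by (induction n) (simp_all add: add_nonneg_nonneg less_imp_le)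

lemma e_step: "e n = e (Suc n) + \<tau> (Suc n) *\<^sub>R r (Suc n)"
  by (simp add: e_def r_def step algebra_simps)

text \<open>Monotonicity of the subdifferential: the subgradient inequalities of two consecutive
  iterates are added, and the multipliers differ by a multiple of the new residual.\<close>

lemma residual_decreasing: "(norm (r (Suc (Suc n))))\<^sup>2 \<le> (norm (r (Suc n)))\<^sup>2"
proof -
  let ?r = "r (Suc n)" and ?s = "r (Suc (Suc n))"
  have "\<tau> (Suc (Suc n)) * (?s \<bullet> (?s - ?r)) \<le> 0"
    using subgradient[of n "Suc n"] subgradient[of "Suc n" n] unfolding step[of "Suc n"]
    by (simp add: r_def inner_add inner_diff inner_commute algebra_simps)
  then have "?s \<bullet> ?s \<le> ?s \<bullet> ?r"
    using step_pos[of "Suc n"] by (simp add: mult_le_0_iff inner_diff_right)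
  moreover have "0 \<le> (?s - ?r) \<bullet> (?s - ?r)" by simp
  ultimately show ?thesis
    by (simp add: power2_norm_eq_inner inner_diff inner_commute)
qed

text \<open>With \<open>T\<close>, \<open>R\<close>, \<open>X\<close> as in the proof, old minus new
  energy is exactly \<open>t n * (gap n - gap (Suc n) - T * R) + (t n)\<^sup>2 / 2 * ((norm (r
  n))\<^sup>2 - R) + T * (X - gap (Suc n))\<close>, and each summand is nonnegative.\<close>

lemma energy_decreasing:
  "t (Suc n) * gap (Suc n) + (t (Suc n))\<^sup>2 * (norm (r (Suc n)))\<^sup>2 / 2 + (norm (e (Suc n)))\<^sup>2 / 2
    \<le> t n * gap n + (t n)\<^sup>2 * (norm (r n))\<^sup>2 / 2 + (norm (e n))\<^sup>2 / 2"
proof -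
  define T where "T = \<tau> (Suc n)"
  define R where "R = (norm (r (Suc n)))\<^sup>2"
  define X where "X = r (Suc n) \<bullet> e (Suc n)"
  have T: "T > 0" using step_pos by (simp add: T_def)
  have e: "(norm (e n))\<^sup>2 = (norm (e (Suc n)))\<^sup>2 + 2 * (T * X) + T\<^sup>2 * R"
    unfolding e_step[of n] T_def R_def X_def power2_norm_eq_inner
    by (simp add: inner_add inner_commute power2_eq_square algebra_simps)
  \<comment> \<open>The subgradient \<open>r (Suc n)\<close> of \<open>G\<close> at
    \<open>p (Suc n)\<close>, tested at \<open>p_dag\<close>.\<close>
  have "gap (Suc n) \<le> X"
    using dag_subgradient[of n]
    by (simp add: gap_def X_def r_def e_def inner_diff inner_commute algebra_simps)
  then have gap: "T * gap (Suc n) \<le> T * X"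
    using T by simp
  \<comment> \<open>For \<open>n = 0\<close> all terms carry the factor \<open>t 0 = 0\<close>. For
    later \<open>n\<close> the same subgradient of \<open>G\<close>, tested at \<open>p n\<close>,
    makes the gap drop by at least \<open>T * R\<close>.\<close>
  have old: "t n * (gap (Suc n) + T * R) \<le> t n * gap n \<and> (t n)\<^sup>2 * R \<le> (t n)\<^sup>2 * (norm (r n))\<^sup>2"
  proof (cases n)
    case (Suc k)
    have pn: "p n = p (Suc n) + T *\<^sub>R r (Suc n)" by (simp add: step T_def r_def algebra_simps)
    have "j n + p n \<bullet> (a (Suc n) - a n) \<le> j (Suc n)"
      using subgradient[of k n] by (simp add: Suc)
    then have "gap (Suc n) + T * R \<le> gap n"
      unfolding gap_def pn R_def power2_norm_eq_inner
      by (simp add: r_def inner_add inner_diff inner_commute algebra_simps)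
    then show ?thesis
      using residual_decreasing[of k] t_nonneg[of n] by (simp add: R_def Suc mult_left_mono)
  qed simp
  have "(t (Suc n))\<^sup>2 * R = (t n)\<^sup>2 * R + 2 * (t n * (T * R)) + T\<^sup>2 * R"
    and "t (Suc n) * gap (Suc n) = t n * gap (Suc n) + T * gap (Suc n)"
    by (simp_all add: T_def power2_eq_square algebra_simps)
  then show ?thesis
    using e gap old unfolding R_def[symmetric] distrib_left by linarith
qed

lemma energy_le:
  "t n * gap n + (t n)\<^sup>2 * (norm (r n))\<^sup>2 / 2 + (norm (e n))\<^sup>2 / 2 \<le> (norm (e 0))\<^sup>2 / 2"
proof (induction n)
  case (Suc n)
  then show ?case using energy_decreasing[of n] by linarith
qed simp

lemma energy_estimate:
  assumes "norm (gd - g) \<le> \<delta>"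
  shows "(norm (e n))\<^sup>2 - 2 * (t n * \<delta>) * norm (e n) + (t n)\<^sup>2 * (norm (r n))\<^sup>2 \<le> (norm (e 0))\<^sup>2"
proof -
  have "- (t n * \<delta> * norm (e n)) \<le> t n * gap n"
  proof (cases n)
    case (Suc k)
    \<comment> \<open>\<open>g - gd\<close> is a subgradient of \<open>G\<close> at
      \<open>p_dag\<close> and has norm at most \<open>\<delta>\<close>.\<close>
    have "- (norm (e n) * \<delta>) \<le> e n \<bullet> (g - gd)"
      using Cauchy_Schwarz_ineq2[of "e n" "g - gd"] assms
        mult_left_mono[OF assms norm_ge_zero[of "e n"]] by (simp add: norm_minus_commute)
    also have "\<dots> \<le> gap n"
      using subgradient_dag[of k]
      by (simp add: Suc gap_def r_def e_def inner_diff inner_commute algebra_simps)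
    finally have "t n * - (norm (e n) * \<delta>) \<le> t n * gap n"
      using t_nonneg by (rule mult_left_mono)
    then show ?thesis by (simp add: algebra_simps)
  qed simp
  then show ?thesis using energy_le[of n] by (simp add: algebra_simps)
qed

section \<open>The discrepancy principle: termination and bounds at stopping\<close>

text \<open>Completing the square in \<open>norm (e n)\<close> eliminates the unknown multiplier
  error.\<close>

lemma residual_bound:
  assumes "norm (gd - g) \<le> \<delta>"
  shows "(t n)\<^sup>2 * ((norm (r n))\<^sup>2 - \<delta>\<^sup>2) \<le> (norm (e 0))\<^sup>2"
proof -
  have "0 \<le> (norm (e n) - t n * \<delta>)\<^sup>2" by simp
  then show ?thesis
    using energy_estimate[OF assms, of n] by (simp add: power2_eq_square algebra_simps)
qed

text \<open>As long as the residual is at least \<open>\<rho> * \<delta>\<close>,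
  \<open>residual_bound\<close> bounds \<open>t n\<close>, which contradicts its divergence.\<close>

lemma discrepancy_reached:
  assumes "norm (gd - g) \<le> \<delta>" "0 < \<delta>" "1 < \<rho>" "filterlim t at_top sequentially"
  shows "\<exists>n\<ge>1. norm (r n) < \<rho> * \<delta>"
proof -
  define c where "c = \<delta>\<^sup>2 * (\<rho>\<^sup>2 - 1)"
  have c: "c > 0" using assms by (simp add: c_def one_less_power)
  have "filterlim (\<lambda>n. (t n)\<^sup>2) at_top sequentially"
    using assms(4) by (intro filterlim_pow_at_top) simp_all
  then have "\<forall>\<^sub>F n in sequentially. (t n)\<^sup>2 > (norm (e 0))\<^sup>2 / c"
    by (simp add: filterlim_at_top_dense)
  then obtain n where n: "n \<ge> 1" "(t n)\<^sup>2 > (norm (e 0))\<^sup>2 / c"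
    using eventually_happens[OF eventually_conj[OF eventually_ge_at_top[of 1]]] by force
  have "(norm (r n))\<^sup>2 < (\<rho> * \<delta>)\<^sup>2"
  proof (rule ccontr)
    assume "\<not> ?thesis"
    then have "c \<le> (norm (r n))\<^sup>2 - \<delta>\<^sup>2"
      by (simp add: c_def power_mult_distrib algebra_simps)
    then have "(t n)\<^sup>2 * c \<le> (norm (e 0))\<^sup>2"
      using residual_bound[OF assms(1), of n] by (meson mult_left_mono order_trans zero_le_power2)
    then show False using n(2) c by (simp add: field_simps)
  qed
  then show ?thesis
    using n(1) assms power2_less_imp_less[of "norm (r n)" "\<rho> * \<delta>"] by auto
qed

text \<open>
  Completing the square in \<open>t n * \<delta>\<close> removes the unknown stopping time \<open>t n\<close>.
\<close>

lemma multiplier_bound_before_stopping: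
  assumes "norm (gd - g) \<le> \<delta>" "0 < \<delta>" "1 < \<rho>" and "n \<ge> 1 \<Longrightarrow> \<rho> * \<delta> \<le> norm (r n)"
  shows "sqrt (\<rho>\<^sup>2 - 1) * norm (e n) \<le> \<rho> * norm (e 0)"
proof -
  let ?x = "t n * \<delta>"
  \<comment> \<open>If the first step already stops, then \<open>n = 0\<close> and no residual bound
    is available, but \<open>t 0 = 0\<close> makes the claim trivial.\<close>
  have "?x\<^sup>2 * \<rho>\<^sup>2 \<le> (t n)\<^sup>2 * (norm (r n))\<^sup>2"
  proof (cases n)
    case (Suc k)
    then have "(\<rho> * \<delta>)\<^sup>2 \<le> (norm (r n))\<^sup>2" using assms by (intro power_mono) auto
    from mult_left_mono[OF this, of "(t n)\<^sup>2"] show ?thesis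
      by (simp add: power_mult_distrib algebra_simps)
  qed simp
  then have "(norm (e n))\<^sup>2 - 2 * ?x * norm (e n) + ?x\<^sup>2 * \<rho>\<^sup>2 \<le> (norm (e 0))\<^sup>2"
    using energy_estimate[OF assms(1), of n] by linarith
  then have "\<rho>\<^sup>2 * ((norm (e n))\<^sup>2 - 2 * ?x * norm (e n) + ?x\<^sup>2 * \<rho>\<^sup>2) \<le> \<rho>\<^sup>2 * (norm (e 0))\<^sup>2"
    by (intro mult_left_mono) auto
  moreover have "0 \<le> (\<rho>\<^sup>2 * ?x - norm (e n))\<^sup>2" by simp
  ultimately have "(\<rho>\<^sup>2 - 1) * (norm (e n))\<^sup>2 \<le> \<rho>\<^sup>2 * (norm (e 0))\<^sup>2"
    by (simp add: power2_eq_square algebra_simps)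
  from real_sqrt_le_mono[OF this] show ?thesis
    using assms(3) by (simp add: real_sqrt_mult)
qed

text \<open>With exact data a proximal step does not move away from \<open>p_dag\<close>, by
  monotonicity. Noise acts like shifting the previous multiplier by
  \<open>\<tau> (Suc n) *\<^sub>R (gd - g)\<close>.\<close>

lemma multiplier_growth:
  assumes "norm (gd - g) \<le> \<delta>"
  shows "norm (e (Suc n)) \<le> norm (e n) + \<tau> (Suc n) * \<delta>"
proof (cases "e (Suc n) = 0")
  case True
  have "0 \<le> \<delta>" using assms norm_ge_zero order_trans by blast
  then show ?thesis using True step_pos[of n] by simp
next
  case False
  let ?T = "\<tau> (Suc n)"
  have "0 \<le> e (Suc n) \<bullet> (a (Suc n) - g)"
    using subgradient_dag[of n] dag_subgradient[of n]
    by (simp add: e_def inner_diff algebra_simps)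
  then have "0 \<le> ?T * (e (Suc n) \<bullet> (a (Suc n) - g))"
    using step_pos[of n] by simp
  also have "\<dots> = e (Suc n) \<bullet> (e n + ?T *\<^sub>R (gd - g)) - (norm (e (Suc n)))\<^sup>2"
    unfolding e_step[of n]
    by (simp add: power2_norm_eq_inner r_def inner_add inner_diff algebra_simps)
  finally have "(norm (e (Suc n)))\<^sup>2 \<le> e (Suc n) \<bullet> (e n + ?T *\<^sub>R (gd - g))" by simp
  also have "\<dots> \<le> norm (e (Suc n)) * norm (e n + ?T *\<^sub>R (gd - g))"
    by (rule norm_cauchy_schwarz)
  finally have "norm (e (Suc n)) \<le> norm (e n + ?T *\<^sub>R (gd - g))"
    using False by (simp add: power2_eq_square)
  also have "\<dots> \<le> norm (e n) + ?T * norm (gd - g)"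
    using norm_triangle_ineq[of "e n" "?T *\<^sub>R (gd - g)"] step_pos[of n] by simp
  also have "\<dots> \<le> norm (e n) + ?T * \<delta>"
    using assms step_pos[of n] by simp
  finally show ?thesis .
qed

text \<open>The left side is the symmetric Bregman distance moved to the image space.
  \<open>B\<close> controls the last step size uniformly, since the stopping index varies with the
  noise.\<close>

lemma bregman_bound_at_stopping:
  assumes noise: "norm (gd - g) \<le> \<delta>" and "0 < \<delta>" "1 < \<rho>"
    and t_lim: "filterlim t at_top sequentially"
    and \<tau>_le: "\<And>n. \<tau> (Suc n) \<le> B"
    and N: "N = (LEAST n. n \<ge> 1 \<and> norm (r n) < \<rho> * \<delta>)"
  shows "e N \<bullet> (a N - g) \<le> (\<rho> + 1) * \<delta> * (\<rho> / sqrt (\<rho>\<^sup>2 - 1) * norm (e 0) + B * \<delta>)"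
proof -
  have "N \<ge> 1 \<and> norm (r N) < \<rho> * \<delta>"
    unfolding N using discrepancy_reached[OF noise assms(2,3) t_lim] 
    by (rule LeastI_ex)
  then have rN: "norm (r N) < \<rho> * \<delta>" and N1: "N \<ge> 1" by auto
  obtain n where n: "N = Suc n" using N1 by (cases N) auto
  have "n < N" by (simp add: n)
  then have "\<not> (n \<ge> 1 \<and> norm (r n) < \<rho> * \<delta>)"
    unfolding N by (rule not_less_Least)
  then have "sqrt (\<rho>\<^sup>2 - 1) * norm (e n) \<le> \<rho> * norm (e 0)"
    using assms by (intro multiplier_bound_before_stopping) auto
  then have "norm (e n) \<le> \<rho> / sqrt (\<rho>\<^sup>2 - 1) * norm (e 0)"
    using \<open>1 < \<rho>\<close> one_less_power[of \<rho> 2] by (simp add: field_simps)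
  moreover have "\<tau> (Suc n) * \<delta> \<le> B * \<delta>" using \<tau>_le \<open>0 < \<delta>\<close> by simp
  ultimately have eN: "norm (e N) \<le> \<rho> / sqrt (\<rho>\<^sup>2 - 1) * norm (e 0) + B * \<delta>"
    using multiplier_growth[OF noise, of n] by (simp add: n)
  have "norm (a N - g) \<le> norm (r N) + norm (gd - g)"
    using norm_triangle_ineq[of "r N" "gd - g"] by (simp add: r_def)
  then have "norm (a N - g) \<le> (\<rho> + 1) * \<delta>"
    using rN noise by (simp add: algebra_simps)
  then have "norm (a N - g) * norm (e N) \<le> (\<rho> + 1) * \<delta> * (\<rho> / sqrt (\<rho>\<^sup>2 - 1) * norm (e 0) + B * \<delta>)"
    using eN assms by (intro mult_mono) auto
  then show "e N \<bullet> (a N - g) \<le> (\<rho> + 1) * \<delta> * (\<rho> / sqrt (\<rho>\<^sup>2 - 1) * norm (e 0) + B * \<delta>)"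
    using norm_cauchy_schwarz[of "e N" "a N - g"] by (simp add: mult.commute)
qed

end

section \<open>The constant and the limit of vanishing noise\<close>

text \<open>Factoring \<open>\<rho>\<^sup>2 - 1\<close> reduces the left side to
  \<open>\<rho> * sqrt (\<rho> + 1) / sqrt (\<rho> - 1)\<close>; then subadditivity of the square
  root applies.\<close>

lemma morozov_constant_le:
  fixes \<rho> :: real
  assumes "1 < \<rho>"
  shows "(\<rho> + 1) * (\<rho> / sqrt (\<rho>\<^sup>2 - 1)) \<le> \<rho> * (sqrt \<rho> + 1) / sqrt (\<rho> - 1)"
proof -
  have "\<rho>\<^sup>2 - 1 = (\<rho> + 1) * (\<rho> - 1)" by (simp add: power2_eq_square algebra_simps)
  then have "(\<rho> + 1) * (\<rho> / sqrt (\<rho>\<^sup>2 - 1)) = \<rho> * ((\<rho> + 1) / sqrt (\<rho> + 1)) / sqrt (\<rho> - 1)"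
    by (simp add: real_sqrt_mult)
  also have "\<dots> = \<rho> * sqrt (\<rho> + 1) / sqrt (\<rho> - 1)"
    using assms by (simp add: real_div_sqrt)
  also have "\<dots> \<le> \<rho> * (sqrt \<rho> + 1) / sqrt (\<rho> - 1)"
    using assms sqrt_add_le_add_sqrt[of \<rho> 1]
    by (intro divide_right_mono mult_left_mono) auto
  finally show ?thesis .
qed

lemma linear_in_bigo_sqrt: "(\<lambda>\<delta>. c * \<delta>) \<in> O[at_right 0](\<lambda>\<delta>. sqrt \<delta>)" for c :: real
proof (rule bigoI[of _ "\<bar>c\<bar>"])
  show "\<forall>\<^sub>F \<delta> in at_right 0. norm (c * \<delta>) \<le> \<bar>c\<bar> * norm (sqrt \<delta>)"
    using eventually_at_right_real[of 0 "1::real"]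
  proof (rule eventually_mono)
    fix \<delta> :: real assume \<delta>: "\<delta> \<in> {0<..<1}"
    then have "\<delta> \<le> sqrt \<delta>"
      by (intro real_le_rsqrt) (simp add: power2_eq_square mult_le_cancel_left1)
    then show "norm (c * \<delta>) \<le> \<bar>c\<bar> * norm (sqrt \<delta>)"
      using \<delta> by (simp add: abs_mult mult_left_mono)
  qed simp
qed

theorem theorem4p3:
  fixes K :: "'a::{real_inner, polish_space} \<Rightarrow> 'b::{real_inner, polish_space}"
    and J :: "'a \<Rightarrow> ereal"
    and g p0 p_dag :: 'b
    and u_dag :: 'a
    and \<tau> :: "nat \<Rightarrow> real"
    and \<rho> :: real
  assumes "bounded_linear K"
    and "ereal_convex J" and "lower_semicontinuous J" and "proper J"
    and "\<And>c::real. weakly_precompact_seq {u. ereal ((norm (K u))\<^sup>2) + J u \<le> ereal c}"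
    and "\<exists>u. J u < \<infinity> \<and> K u = g"
    and "\<And>n. n \<ge> 1 \<Longrightarrow> \<tau> n > 0"
    and "filterlim (\<lambda>n. \<Sum>k=1..n. \<tau> k) at_top sequentially"
    and "bdd_above (\<tau> ` {1..})"
    and "J_minimizing_solution J K g u_dag"
    and "adjoint K p_dag \<in> subdifferential J u_dag"
    and "\<rho> > 1"
    and "p0 \<noteq> p_dag"
  shows "\<exists>E::real \<Rightarrow> real. E \<in> O[at_right 0](\<lambda>\<delta>. sqrt \<delta>) \<and>
    (\<forall>\<^sub>F \<delta> in at_right 0. \<forall>gd u p.
       norm (gd - g) \<le> \<delta> \<longrightarrow> augmented_lagrangian K J \<tau> p0 gd u p \<longrightarrow>
       (let N = morozov_index \<rho> K u \<delta> gd in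
          sym_bregman (adjoint K (p N)) (adjoint K p_dag) (u N) u_dag
            \<le> (1 + E \<delta>) * (\<rho> * (sqrt \<rho> + 1) / sqrt (\<rho> - 1)) * norm (p0 - p_dag) * \<delta>))"
proof -
  interpret K: bounded_linear K by fact
  have Ku: "K u_dag = g"
    using assms(10) by (simp add: J_minimizing_solution_def is_arg_min_def)
  have adj: "(adjoint K q - adjoint K q') \<bullet> (v - w) = (q - q') \<bullet> (K v - K w)" for q q' v w
    by (simp add: inner_diff adjoint_inner[OF assms(1)])
  obtain j_dag where j_dag: "J u_dag = ereal j_dag"
    using subdifferential_proper_finite[OF assms(4,11)] by (cases "J u_dag") auto
  have dag: "ereal (j_dag + p_dag \<bullet> (K v - g)) \<le> J v" for v
    using assms(11) by (simp add: subdifferential_def inner_diff_right adjoint_inner[OF assms(1)] Ku j_dag)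
  obtain B where "\<forall>x\<in>\<tau> ` {1..}. x \<le> B" using assms(9) by (auto simp: bdd_above_def)
  then have B: "\<tau> (Suc n) \<le> B" for n by simp
  define C where "C = \<rho> * (sqrt \<rho> + 1) / sqrt (\<rho> - 1)"
  define e0 where "e0 = norm (p0 - p_dag)"
  have C: "C > 0" using assms(12) by (simp add: C_def add_pos_pos)
  have e0: "e0 > 0" using assms(13) by (simp add: e0_def)
  \<comment> \<open>Chosen so that \<open>c * \<delta> * C * e0 * \<delta>\<close> equals the
    last-step remainder \<open>(\<rho> + 1) * B * \<delta>\<^sup>2\<close>; the division uses
    \<open>p0 \<noteq> p_dag\<close>.\<close>
  define c where "c = (\<rho> + 1) * B / (C * e0)"
  have main: "sym_bregman (adjoint K (p N)) (adjoint K p_dag) (u N) u_dag \<le> (1 + c * \<delta>) * C * e0 * \<delta>"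
    if \<delta>: "0 < \<delta>" and noise: "norm (gd - g) \<le> \<delta>" and run: "augmented_lagrangian K J \<tau> p0 gd u p"
      and N: "N = morozov_index \<rho> K u \<delta> gd" for \<delta> gd u p N
  proof -
    have argmin: "is_arg_min (\<lambda>v. ereal (\<tau> (Suc n) / 2 * (norm (K v - gd))\<^sup>2) + J v
                    - ereal (p n \<bullet> (K v - gd))) (\<lambda>v. True) (u (Suc n))"
      and step: "p (Suc n) = p n + \<tau> (Suc n) *\<^sub>R (gd - K (u (Suc n)))" for n
      using run unfolding augmented_lagrangian_def by (auto dest!: spec[of _ "Suc n"])
    have p0: "p 0 = p0" using run by (simp add: augmented_lagrangian_def)
    define j where "j n = real_of_ereal (J (u n))" for n
    have j: "J (u (Suc n)) = ereal (j (Suc n))" for n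
      using argmin_subgradient_ineq(1)[OF K.linear_axioms assms(2,4) argmin] by (simp add: j_def ereal_real')
    have sub: "ereal (j (Suc n) + p (Suc n) \<bullet> (K v - K (u (Suc n)))) \<le> J v" for n v
      using argmin_subgradient_ineq(2)[OF K.linear_axioms assms(2,4) argmin] by (simp add: j step)
    interpret dual_proximal_point p "\<lambda>n. K (u n)" j \<tau> g gd p_dag j_dag
      using assms(7) step sub[of _ "u (Suc _)"] sub[of _ u_dag] dag[of "u (Suc _)"]
      by unfold_locales (simp_all add: j j_dag Ku)
    have t_lim: "filterlim t at_top sequentially"
      using assms(8) by (simp add: t_def[abs_def])
    have "sym_bregman (adjoint K (p N)) (adjoint K p_dag) (u N) u_dag = e N \<bullet> (K (u N) - g)"
      by (simp add: sym_bregman_def adj Ku e_def)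
    also have "\<dots> \<le> (\<rho> + 1) * \<delta> * (\<rho> / sqrt (\<rho>\<^sup>2 - 1) * norm (e 0) + B * \<delta>)"
      using N by (intro bregman_bound_at_stopping[OF noise \<delta> assms(12) t_lim B])
        (simp add: morozov_index_def r_def)
    also have "\<dots> = (\<rho> + 1) * (\<rho> / sqrt (\<rho>\<^sup>2 - 1)) * (e0 * \<delta>) + (\<rho> + 1) * B * \<delta>\<^sup>2"
      by (simp add: e_def p0 e0_def power2_eq_square algebra_simps)
    also have "\<dots> \<le> C * (e0 * \<delta>) + (\<rho> + 1) * B * \<delta>\<^sup>2"
      using mult_right_mono[OF morozov_constant_le[OF assms(12)], of "e0 * \<delta>"] e0 \<delta>
      by (simp add: C_def)
    also have "\<dots> = (1 + c * \<delta>) * C * e0 * \<delta>"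
      using C e0 by (simp add: c_def field_simps power2_eq_square)
    finally show ?thesis .
  qed
  show ?thesis
    \<comment> \<open>The witness \<open>c * \<delta>\<close> does not depend on the data or the
      run, so the estimate is uniform in them.\<close>
    using linear_in_bigo_sqrt[of c] eventually_mono[OF eventually_at_right_less[of "0::real"]] main
    unfolding C_def e0_def Let_def by (intro exI[of _ "\<lambda>\<delta>. c * \<delta>"] conjI) (auto elim!: eventually_mono)
qed

end
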